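(* Let $f\in QA$. Then $N(f)$ is connected if and only if $I(f)\cap B(f)=\emptyset$.
   Context: For $K>0$ and $\theta\in\mathbb{R}$, let $h_{K,\theta}:\mathbb{C}\to\mathbb{C}$ be the affine stretch $h_{K,\theta}(z)=\left(\frac{K+1}{2}\right)z+e^{2i\theta}\left(\frac{K-1}{2}\right)\overline{z}$. Let $$U=\{0<|z|<1,\ -\pi/4<\arg(z)\le \pi/4\}\cup\{|z|>1,\ -\pi/4<\arg(z)\le\pi/4\}\cup\{1\}\subset\mathbb{C},$$ and let $QA$ be the set of maps $f:\mathbb{C}\to\mathbb{C}$ of the form $f=g\circ h$ with $g(z)=z^2+c$, $c\in\mathbb{C}$, and $h=h_{K,\theta}$ with $Ke^{i\theta}\in U$. The escaping set is $I(f)=\{z\in\mathbb{C}: f^{n}(z)\to\infty\}$, where $f^n$ is the $n$-th iterate. $N(f)=\{z\in\mathbb{C}: \text{there is } T<\infty \text{ with } |f^n(z)|<T \text{ for all } n\in\mathbb{N}\}$ is the set of points with bounded orbit (it equals the complement of $I(f)$). The branch set $B(f)$ is the set of points at which $f$ is not locally injective. *)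

theory Defs
  imports "HOL-Complex_Analysis.Complex_Analysis"
begin

definition affine_stretch :: "real \<Rightarrow> real \<Rightarrow> complex \<Rightarrow> complex" where
  "affine_stretch K \<theta> z =
     of_real ((K + 1) / 2) * z
     + exp (2 * \<i> * of_real \<theta>) * of_real ((K - 1) / 2) * cnj z"

text \<open>\<open>Arg\<close> is the principal argument, with values in the interval from \<open>- pi\<close>
  (excluded) to \<open>pi\<close> (included).\<close>

definition stretch_params :: "complex set" where
  "stretch_params =
     {z. 0 < cmod z \<and> cmod z < 1 \<and> - pi / 4 < Arg z \<and> Arg z \<le> pi / 4}
     \<union> {z. 1 < cmod z \<and> - pi / 4 < Arg z \<and> Arg z \<le> pi / 4}
     \<union> {1}"

definition QA :: "(complex \<Rightarrow> complex) set" where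
  "QA = {(\<lambda>z. z\<^sup>2 + c) \<circ> affine_stretch K \<theta> | c K \<theta>.
           K > 0 \<and> of_real K * exp (\<i> * of_real \<theta>) \<in> stretch_params}"

definition escaping_set :: "(complex \<Rightarrow> complex) \<Rightarrow> complex set" where
  "escaping_set f = {z. filterlim (\<lambda>n. (f ^^ n) z) at_infinity sequentially}"

definition bounded_orbit_set :: "(complex \<Rightarrow> complex) \<Rightarrow> complex set" where
  "bounded_orbit_set f = {z. \<exists>T::real. \<forall>n. cmod ((f ^^ n) z) < T}"

definition locally_injective_at :: "(complex \<Rightarrow> complex) \<Rightarrow> complex \<Rightarrow> bool" where
  "locally_injective_at f z \<longleftrightarrow> (\<exists>V. open V \<and> z \<in> V \<and> inj_on f V)"

definition branch_set :: "(complex \<Rightarrow> complex) \<Rightarrow> complex set" where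
  "branch_set f = {z. \<not> locally_injective_at f z}"

end

theory Submission
  imports Defs
begin

text \<open>
  The map \<open>f(z) = h(z)\<^sup>2 + c\<close> is continuous, open, surjective, and two-to-one with fibres
  \<open>{z, -z}\<close>, because \<open>h\<close> is an invertible real-linear map. Hence \<open>0\<close> is its only branch point. The
  set \<open>N\<close> of bounded orbits and the escaping set are complementary, because outside a large disc \<open>D\<close> of
  radius \<open>R\<close> the map at least doubles the modulus. So the claim is that \<open>N\<close> is connected
  precisely when \<open>0 \<in> N\<close>. The map need not be holomorphic, but openness and evenness suffice.

  If \<open>0 \<in> N\<close>, then all the preimages \<open>f\<^sup>-\<^sup>n(D)\<close>, which decrease to \<open>N\<close>, are connected: each of them
  contains the critical value \<open>f(0)\<close>, whose fibre is the single point \<open>0\<close>. A clopen piece of the next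
  preimage that misses \<open>0\<close> would be mapped onto a clopen set missing \<open>f(0)\<close>, hence is empty
  (\<open>connected_vimage_of_singleton_fibre\<close>). A decreasing intersection of compact connected sets is
  connected.

  If \<open>0 \<notin> N\<close>, then \<open>0\<close> lies in an unbounded component of the complement of \<open>N\<close>: on a bounded component
  the maximum principle, which needs only openness of the iterates (\<open>norm_le_on_bounded_open_set\<close>),
  would bound all orbits by \<open>R\<close>. So there is a continuous argument function on \<open>N\<close>. But \<open>N\<close> is
  nonempty and invariant under \<open>z \<mapsto> -z\<close>, and a connected set of this kind cannot carry a continuous
  argument: from \<open>z\<close> to \<open>-z\<close> the argument changes by an odd multiple of \<open>\<pi>\<close>, while the change is an
  odd function of \<open>z\<close> and so has a zero (\<open>bounded_component_of_symmetric_continuum\<close>).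
\<close>

section \<open>Open maps, the maximum principle and symmetric continua\<close>

text \<open>A relatively clopen part of the preimage has a relatively clopen image: open since \<open>f\<close> is an open map
  and the full preimage is taken, closed by compactness. As \<open>E\<close> is connected, every nonempty clopen
  part is mapped onto \<open>E\<close> and therefore contains the whole fibre \<open>{a}\<close>. Two complementary parts
  cannot both contain \<open>a\<close>.\<close>

lemma connected_vimage_of_singleton_fibre:
  fixes f :: "'a::metric_space \<Rightarrow> 'b::t2_space"
  assumes cont: "continuous_on UNIV f"
    and opn: "\<And>U. open U \<Longrightarrow> open (f ` U)"
    and E: "connected E" and comp: "compact (f -` E)"
    and a: "f a \<in> E" and fibre: "\<And>z. f z = f a \<Longrightarrow> z = a"
  shows "connected (f -` E)"
proof -
  let ?S = "f -` E"
  have *: "T = {} \<or> a \<in> T"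
    if T: "openin (top_of_set ?S) T" "closedin (top_of_set ?S) T" for T
  proof -
    obtain U where U: "open U" "T = ?S \<inter> U"
      using T(1) by (auto simp: openin_open)
    have "f ` T = E \<inter> f ` U"
      using U(2) by auto
    then have "openin (top_of_set E) (f ` T)"
      using opn[OF U(1)] by (auto simp: openin_open)
    moreover have "compact (f ` T)"
      using closedin_compact[OF comp T(2)] cont
      by (meson compact_continuous_image continuous_on_subset subset_UNIV)
    then have "closedin (top_of_set E) (f ` T)"
      using \<open>f ` T = E \<inter> f ` U\<close> by (simp add: closed_subset compact_imp_closed)
    ultimately have "f ` T = {} \<or> f ` T = E"
      using E by (auto simp: connected_clopen)
    then show ?thesis
      using a fibre by (metis image_iff image_is_empty)
  qed
  show ?thesis
    unfolding connected_clopen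
  proof (intro allI impI)
    fix T assume T: "openin (top_of_set ?S) T \<and> closedin (top_of_set ?S) T"
    then have "openin (top_of_set ?S) (?S - T)" "closedin (top_of_set ?S) (?S - T)"
      using openin_diff[of "top_of_set ?S" ?S T] closedin_diff[of "top_of_set ?S" ?S T]
      by auto
    then show "T = {} \<or> T = ?S"
      using *[of T] *[of "?S - T"] T openin_imp_subset by blast
  qed
qed

text \<open>The maximum principle for open maps: at an interior maximum of the modulus, the image would be a
  neighbourhood of a point of largest modulus, and it could be moved radially outwards. It replaces
  the holomorphic maximum principle, which is unavailable because the affine stretch need not be holomorphic.\<close>

lemma norm_le_on_bounded_open_set:
  fixes F :: "complex \<Rightarrow> complex"
  assumes cont: "continuous_on UNIV F"
    and opn: "\<And>U. open U \<Longrightarrow> open (F ` U)"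
    and W: "open W" "bounded W"
    and frontier: "\<And>z. z \<in> frontier W \<Longrightarrow> cmod (F z) \<le> R"
    and "0 \<le> R" and w: "w \<in> W"
  shows "cmod (F w) \<le> R"
proof (rule ccontr)
  assume "\<not> cmod (F w) \<le> R"
  then have big: "R < cmod (F w)" by simp
  have wc: "w \<in> closure W" using w closure_subset by blast
  have "continuous_on (closure W) (\<lambda>z. cmod (F z))"
    by (rule continuous_on_norm[OF continuous_on_subset[OF cont]]) simp
  then obtain p where p: "p \<in> closure W" "\<And>z. z \<in> closure W \<Longrightarrow> cmod (F z) \<le> cmod (F p)"
    using continuous_attains_sup[of "closure W" "\<lambda>z. cmod (F z)"] W wc by fastforce
  have pos: "cmod (F w) \<le> cmod (F p)" using p wc by blast
  then have "p \<notin> frontier W"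
    using frontier[of p] big by force
  then have "p \<in> W" using p W by (auto simp: frontier_def interior_open)
  then have "F p \<in> F ` W" "open (F ` W)"
    using opn W by auto
  then obtain e where e: "e > 0" "cball (F p) e \<subseteq> F ` W"
    using open_contains_cball by blast
  \<comment> \<open>The point of the ball that lies radially beyond \<open>F p\<close>.\<close>
  define q where "q = F p + of_real e * sgn (F p)"
  have nz: "F p \<noteq> 0"
    using pos big \<open>0 \<le> R\<close> by auto
  have "q \<in> cball (F p) e"
    using nz e(1) by (simp add: q_def dist_norm norm_mult norm_sgn)
  then obtain z where z: "z \<in> W" "F z = q" using e by auto
  have "q = of_real (cmod (F p) + e) * sgn (F p)"
    using nz by (simp add: q_def sgn_eq field_simps)
  then have "cmod q = cmod (F p) + e"
    using nz e(1) by (simp add: norm_mult norm_sgn del: of_real_add)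
  then show False
    using p(2)[of z] z closure_subset[of W] e(1) by auto
qed

text \<open>If \<open>0\<close> were in an unbounded component, Borsuk's criterion would make \<open>x / |x|\<close> inessential on \<open>S\<close>
  and so give a continuous argument \<open>g\<close> there. The continuous function \<open>d(x) = g(-x) - g(x)\<close> satisfies
  \<open>exp(i d) = -1\<close>, hence never vanishes; but it is odd, so it must vanish on a connected set.\<close>

lemma bounded_component_of_symmetric_continuum:
  fixes S :: "complex set"
  assumes S: "compact S" "S \<noteq> {}" "connected S"
    and sym: "\<And>z. z \<in> S \<Longrightarrow> - z \<in> S" and "0 \<notin> S"
  shows "bounded (connected_component_set (- S) 0)"
proof (rule ccontr)
  assume "\<not> ?thesis"
  then have "\<exists>a. homotopic_with_canon (\<lambda>x. True) S (sphere 0 1)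
        (\<lambda>x. inverse (norm (x - 0)) *\<^sub>R (x - 0)) (\<lambda>x. a)"
    using Borsuk_map_essential_bounded_component[of S 0] S \<open>0 \<notin> S\<close> by blast
  then obtain g :: "complex \<Rightarrow> real" where g: "continuous_on S g"
      "\<And>x. x \<in> S \<Longrightarrow> inverse (cmod x) *\<^sub>R x = exp (\<i> * of_real (g x))"
    unfolding inessential_eq_continuous_logarithm_circle diff_0_right by blast
  define d where "d x = g (- x) - g x" for x
  have odd: "exp (\<i> * of_real (d x)) = -1" if "x \<in> S" for x
  proof -
    have "exp (\<i> * of_real (d x)) = exp (\<i> * of_real (g (-x))) / exp (\<i> * of_real (g x))"
      by (simp add: d_def algebra_simps exp_diff)
    moreover have "exp (\<i> * of_real (g (-x))) = - exp (\<i> * of_real (g x))"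
      by (simp flip: g(2)[OF that] g(2)[OF sym[OF that]])
    ultimately show ?thesis by simp
  qed
  have cont: "continuous_on S d"
  proof -
    have "continuous_on S (g \<circ> uminus)"
      by (rule continuous_on_compose)
         (auto intro!: continuous_intros continuous_on_subset[OF g(1)] sym)
    then show ?thesis
      unfolding d_def using g(1) by (auto simp: o_def intro: continuous_intros)
  qed
  obtain x where x: "x \<in> S" using S by auto
  have "d x \<in> d ` S" "d (- x) \<in> d ` S"
    using x sym by auto
  then have ends: "d x \<in> d ` S" "- d x \<in> d ` S"
    by (simp_all add: d_def)
  have "connected (d ` S)"
    using cont S(3) by (rule connected_continuous_image)
  \<comment> \<open>The function \<open>d\<close> is odd, so it vanishes somewhere on the connected set \<open>S\<close>.\<close>
  then have "{- \<bar>d x\<bar>..\<bar>d x\<bar>} \<subseteq> d ` S"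
    by (rule connected_contains_Icc) (use ends in \<open>auto simp only: abs_if minus_minus split: if_splits\<close>)
  moreover have "0 \<in> {- \<bar>d x\<bar>..\<bar>d x\<bar>}" by simp
  ultimately have "0 \<in> d ` S" by (rule subsetD)
  then obtain y where "y \<in> S" "d y = 0" by auto
  then show False using odd[of y] by simp
qed

section \<open>Dynamics of even expanding maps\<close>

text \<open>
  The features of \<open>z \<mapsto> h(z)\<^sup>2 + c\<close> that the argument uses. The condition on fibres expresses at once that
  the map is even, that \<open>0\<close> is alone in its fibre, and that there is no other branch point.
\<close>

locale even_expanding_map =
  fixes f :: "complex \<Rightarrow> complex" and R :: real
  assumes cont: "continuous_on UNIV f"
    and open_image: "\<And>U. open U \<Longrightarrow> open (f ` U)"
    and surj: "surj f"
    and fibre: "\<And>z w. f z = f w \<longleftrightarrow> z = w \<or> z = - w"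
    and R_pos: "R > 0"
    and expanding: "\<And>z. R \<le> cmod z \<Longrightarrow> 2 * cmod z \<le> cmod (f z)"
begin

lemma continuous_iterate: "continuous_on UNIV (f ^^ n)"
proof (induction n)
  case (Suc n)
  then show ?case
    using continuous_on_compose[of UNIV "f ^^ n" f] continuous_on_subset[OF cont] by simp
qed (simp add: id_def)

lemma open_image_iterate: "open U \<Longrightarrow> open ((f ^^ n) ` U)"
  by (induction n) (simp_all only: funpow.simps image_comp[symmetric] open_image image_id id_apply)

lemma iterate_expanding:
  assumes "R \<le> cmod z"
  shows "2 ^ k * cmod z \<le> cmod ((f ^^ k) z)"
proof (induction k)
  case (Suc k)
  have "R \<le> 1 * cmod z" using assms by simp
  also have "\<dots> \<le> 2 ^ k * cmod z" by (intro mult_right_mono) auto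
  also note Suc
  finally have "2 * cmod ((f ^^ k) z) \<le> cmod ((f ^^ Suc k) z)"
    using expanding by simp
  with Suc show ?case by simp
qed simp

lemma escapes:
  assumes "R < cmod ((f ^^ n) z)"
  shows "z \<in> escaping_set f"
proof -
  define w where "w = (f ^^ n) z"
  have w: "R < cmod w" using assms by (simp add: w_def)
  have two: "filterlim (\<lambda>k. 2 ^ k :: real) at_top sequentially"
    using filterlim_at_infinity_imp_norm_at_top[OF filterlim_realpow_sequentially_gt1[of "2::real"]]
    by simp
  have "0 < cmod w" using w R_pos by linarith
  then have "filterlim (\<lambda>k. cmod w * 2 ^ k) at_top sequentially"
    by (rule filterlim_tendsto_pos_mult_at_top[OF tendsto_const _ two])
  then have "filterlim (\<lambda>k. cmod ((f ^^ k) w)) at_top sequentially"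
    by (rule filterlim_at_top_mono)
       (use iterate_expanding[of w] w in \<open>auto simp: mult.commute\<close>)
  then have "filterlim (\<lambda>k. (f ^^ (k + n)) z) at_infinity sequentially"
    unfolding w_def funpow_add by (auto intro: filterlim_norm_at_top_imp_at_infinity)
  then show ?thesis
    unfolding escaping_set_def filterlim_iff mem_Collect_eq
    using eventually_sequentially_seg by blast
qed

lemma escaping_not_bounded: "escaping_set f \<inter> bounded_orbit_set f = {}"
proof -
  have False if lim: "filterlim (\<lambda>n. (f ^^ n) z) at_infinity sequentially"
    and T: "\<And>n. cmod ((f ^^ n) z) < T" for z and T :: real
  proof -
    have "\<forall>\<^sub>F n in sequentially. T \<le> cmod ((f ^^ n) z)"
      using filterlim_at_infinity_imp_norm_at_top[OF lim] by (simp add: filterlim_at_top)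
    then show False using T eventually_sequentially by (meson linorder_not_le order_refl)
  qed
  then show ?thesis
    unfolding escaping_set_def bounded_orbit_set_def by blast
qed

lemma bounded_orbit_set_eq_INT: "bounded_orbit_set f = (\<Inter>n. (f ^^ n) -` cball 0 R)"
proof
  show "bounded_orbit_set f \<subseteq> (\<Inter>n. (f ^^ n) -` cball 0 R)"
    using escapes escaping_not_bounded by (fastforce simp: not_le)
  show "(\<Inter>n. (f ^^ n) -` cball 0 R) \<subseteq> bounded_orbit_set f"
    by (fastforce simp: bounded_orbit_set_def intro!: exI[of _ "R + 1"]
        intro: order.strict_trans1)
qed

lemma escaping_set_eq: "escaping_set f = - bounded_orbit_set f"
  using escapes escaping_not_bounded unfolding bounded_orbit_set_eq_INT by (fastforce simp: not_le)

text \<open>Points outside the disc are moved away, so an orbit that has left the disc does not come back.\<close>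

lemma pullback_Suc_subset: "(f ^^ Suc n) -` cball 0 R \<subseteq> (f ^^ n) -` cball 0 R"
proof
  fix z assume "z \<in> (f ^^ Suc n) -` cball 0 R"
  then show "z \<in> (f ^^ n) -` cball 0 R"
    using expanding[of "(f ^^ n) z"] R_pos by fastforce
qed

lemma pullback_antimono: "m \<le> n \<Longrightarrow> (f ^^ n) -` cball 0 R \<subseteq> (f ^^ m) -` cball 0 R"
  by (rule lift_Suc_antimono_le[of "\<lambda>n. (f ^^ n) -` cball 0 R"]) (rule pullback_Suc_subset)

lemma compact_pullback: "compact ((f ^^ n) -` cball 0 R)"
proof -
  have "closed ((f ^^ n) -` cball 0 R)"
    using continuous_iterate by (simp add: continuous_closed_vimage continuous_on_eq_continuous_at)
  moreover have "(f ^^ n) -` cball 0 R \<subseteq> cball 0 R"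
    using pullback_antimono[of 0 n] by simp
  ultimately show ?thesis
    by (meson bounded_cball bounded_subset compact_eq_bounded_closed)
qed

lemma compact_bounded_orbit_set: "compact (bounded_orbit_set f)"
  unfolding bounded_orbit_set_eq_INT by (intro compact_Inter) (auto simp: compact_pullback)

text \<open>The empty set is connected, so the converse direction needs this: by surjectivity, the
  decreasing compact preimages of the disc are all nonempty.\<close>

lemma bounded_orbit_set_nonempty: "bounded_orbit_set f \<noteq> {}"
proof -
  have "(f ^^ n) -` cball 0 R \<noteq> {}" for n
  proof -
    obtain z where "(f ^^ n) z = 0"
      using surj_fn[OF surj, of n] by (metis surjD)
    then have "z \<in> (f ^^ n) -` cball 0 R" using R_pos by simp
    then show ?thesis by blast
  qed
  then show ?thesis
    unfolding bounded_orbit_set_eq_INT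
    by (intro compact_nest compact_pullback pullback_antimono)
qed

lemma bounded_orbit_set_uminus:
  assumes "z \<in> bounded_orbit_set f"
  shows "- z \<in> bounded_orbit_set f"
proof -
  have eq: "(f ^^ Suc n) (- z) = (f ^^ Suc n) z" for n
    using fibre[of "- z" z] by (simp add: funpow_Suc_right del: funpow.simps)
  have "cmod ((f ^^ n) (- z)) \<le> R" for n
    using assms eq[of "n - 1"] unfolding bounded_orbit_set_eq_INT
    by (cases n) (auto dest!: spec[of _ n])
  then show ?thesis
    by (auto simp: bounded_orbit_set_eq_INT)
qed

text \<open>Each preimage \<open>f\<^sup>-\<^sup>n(D)\<close> of the disc contains the critical value, so pulling it back once more
  keeps it connected; \<open>N\<close> is their decreasing intersection.\<close>

lemma connected_if_critical_point_bounded: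
  assumes "0 \<in> bounded_orbit_set f"
  shows "connected (bounded_orbit_set f)"
proof -
  have "connected ((f ^^ n) -` cball 0 R)" for n
  proof (induction n)
    case (Suc n)
    have eq: "(f ^^ Suc n) -` cball 0 R = f -` ((f ^^ n) -` cball 0 R)"
      by (auto simp: funpow_Suc_right simp del: funpow.simps)
    have "f 0 \<in> (f ^^ n) -` cball 0 R"
      using assms eq unfolding bounded_orbit_set_eq_INT by blast
    then show ?case
      unfolding eq
      using connected_vimage_of_singleton_fibre[OF cont open_image Suc, of 0]
        compact_pullback[of "Suc n"] fibre[of _ 0] unfolding eq by auto
  qed simp
  then show ?thesis
    unfolding bounded_orbit_set_eq_INT
    by (intro connected_nest compact_pullback pullback_antimono)
qed

text \<open>The boundary of a bounded component \<open>W\<close> consists of points with orbits in the disc. By the maximum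
  principle applied to every iterate, orbits of points of \<open>W\<close> stay in the disc as well.\<close>

lemma unbounded_component_of_escaping_point:
  assumes "w \<notin> bounded_orbit_set f"
  shows "\<not> bounded (connected_component_set (- bounded_orbit_set f) w)" (is "\<not> bounded ?W")
proof
  assume bd: "bounded ?W"
  have cl: "closed (bounded_orbit_set f)"
    using compact_bounded_orbit_set compact_imp_closed by blast
  have "?W \<in> components (- bounded_orbit_set f)"
    using assms by (simp add: componentsI)
  then have fr: "frontier ?W \<subseteq> bounded_orbit_set f"
    by (rule frontier_of_components_closed_complement[OF cl])
  have "w \<in> ?W"
    using assms by simp
  have "cmod ((f ^^ n) w) \<le> R" for n
  proof (rule norm_le_on_bounded_open_set[OF continuous_iterate open_image_iterate _ bd])
    show "open ?W"
      using cl by (simp add: open_Compl open_connected_component)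
    show "cmod ((f ^^ n) z) \<le> R" if "z \<in> frontier ?W" for z
      using fr that unfolding bounded_orbit_set_eq_INT by auto
  qed (use R_pos \<open>w \<in> ?W\<close> in auto)
  then show False
    using assms by (auto simp: bounded_orbit_set_eq_INT)
qed

text \<open>The ball about \<open>z \<noteq> 0\<close> of radius \<open>|z|\<close> contains no pair of antipodal points, whereas
  every ball about \<open>0\<close> does.\<close>

lemma branch_set_eq: "branch_set f = {0}"
proof -
  have "locally_injective_at f z" if "z \<noteq> 0" for z
  proof -
    have "inj_on f (ball z (cmod z))"
    proof (rule inj_onI)
      fix x y assume xy: "x \<in> ball z (cmod z)" "y \<in> ball z (cmod z)" and "f x = f y"
      then have "x = y \<or> x = - y" using fibre by blast
      moreover have "x \<noteq> - y"
      proof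
        assume "x = - y"
        then have "2 * cmod z = cmod ((z - x) + (z - y))"
          by (simp add: norm_mult flip: mult_2)
        also have "\<dots> \<le> cmod (z - x) + cmod (z - y)"
          by (rule norm_triangle_ineq)
        finally show False using xy by (simp add: dist_norm)
      qed
      ultimately show "x = y" by blast
    qed
    then show ?thesis
      using that unfolding locally_injective_at_def by (intro exI[of _ "ball z (cmod z)"]) auto
  qed
  moreover have "\<not> locally_injective_at f 0"
  proof
    assume "locally_injective_at f 0"
    then obtain V where V: "open V" "0 \<in> V" "inj_on f V"
      unfolding locally_injective_at_def by blast
    then obtain e where e: "e > 0" "cball 0 e \<subseteq> V"
      using open_contains_cball by blast
    then have "complex_of_real e \<in> V" "- complex_of_real e \<in> V"
      by auto
    moreover have "f (complex_of_real e) = f (- complex_of_real e)"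
      using fibre by auto
    ultimately show False
      using inj_onD[OF V(3)] e(1) by fastforce
  qed
  ultimately show ?thesis
    unfolding branch_set_def by auto
qed

theorem connected_iff:
  "connected (bounded_orbit_set f) \<longleftrightarrow> escaping_set f \<inter> branch_set f = {}"
proof -
  have "connected (bounded_orbit_set f) \<longleftrightarrow> 0 \<in> bounded_orbit_set f"
    using connected_if_critical_point_bounded unbounded_component_of_escaping_point[of 0]
      bounded_component_of_symmetric_continuum[OF compact_bounded_orbit_set
        bounded_orbit_set_nonempty _ bounded_orbit_set_uminus]
    by blast
  then show ?thesis
    by (auto simp: escaping_set_eq branch_set_eq)
qed

end

section \<open>Quadratic maps composed with affine stretches\<close>

lemma linear_affine_stretch: "linear (affine_stretch K \<theta>)"
  by (rule linearI)
     (simp_all only: affine_stretch_def complex_cnj_add complex_cnj_scaleR distrib_left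
        scaleR_add_right mult_scaleR_right add_ac)

text \<open>For \<open>K > 0\<close> the stretch has singular values \<open>K\<close> and \<open>1\<close>, so the constant is its least expansion
  factor.\<close>

lemma norm_affine_stretch_ge: "min K 1 * cmod z \<le> cmod (affine_stretch K \<theta> z)"
proof -
  have e: "cmod (exp (2 * \<i> * of_real \<theta>)) = 1"
    by (simp add: norm_exp_eq_Re)
  have "min K 1 * cmod z \<le> (\<bar>(K + 1) / 2\<bar> - \<bar>(K - 1) / 2\<bar>) * cmod z"
    by (rule mult_right_mono) (auto simp: min_def abs_if field_simps)
  also have "\<dots> = cmod (of_real ((K + 1) / 2) * z)
      - cmod (exp (2 * \<i> * of_real \<theta>) * of_real ((K - 1) / 2) * cnj z)"
    by (simp only: norm_mult e norm_of_real complex_mod_cnj) (simp add: algebra_simps)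
  also have "\<dots> \<le> cmod (affine_stretch K \<theta> z)"
    unfolding affine_stretch_def by (rule norm_diff_ineq)
  finally show ?thesis .
qed

lemma even_expanding_map_QA:
  fixes K \<theta> :: real and c :: complex
  assumes "K > 0"
  defines "f \<equiv> (\<lambda>z. z\<^sup>2 + c) \<circ> affine_stretch K \<theta>"
  shows "\<exists>R. even_expanding_map f R"
proof -
  let ?h = "affine_stretch K \<theta>"
  define m where "m = min K 1"
  have m: "0 < m" "m \<le> 1" using assms(1) by (auto simp: m_def)
  have h_ge: "m * cmod z \<le> cmod (?h z)" for z
    unfolding m_def by (rule norm_affine_stretch_ge)
  have lin: "linear ?h" by (rule linear_affine_stretch)
  have "z = 0" if "?h z = 0" for z
    using h_ge[of z] m that by (simp add: mult_le_0_iff)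
  then have inj: "inj ?h"
    using lin linear_injective_0 by blast
  then have surj: "surj ?h"
    using lin linear_injective_imp_surjective by blast
  \<comment> \<open>If \<open>|z| \<ge> R\<close>, then \<open>m\<^sup>2 |z| \<ge> 2 + |c|\<close> and \<open>|z| \<ge> 1\<close>, so
    \<open>|f z| \<ge> m\<^sup>2 |z|\<^sup>2 - |c| \<ge> (2 + |c|) |z| - |c| \<ge> 2 |z|\<close>.\<close>
  define R where "R = (2 + cmod c) / m\<^sup>2"
  have "even_expanding_map f R"
  proof
    show "continuous_on UNIV f"
      unfolding f_def
      by (rule continuous_on_compose[OF linear_continuous_on])
         (auto intro!: continuous_intros simp: lin linear_conv_bounded_linear[symmetric])
    show "open (f ` U)" if "open U" for U
    proof -
      have "open (?h ` U)"
        using open_surjective_linear_image[OF that lin surj] .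
      moreover have "\<not> (\<lambda>z. z\<^sup>2 + c) constant_on (UNIV :: complex set)"
      proof
        assume "(\<lambda>z. z\<^sup>2 + c) constant_on (UNIV :: complex set)"
        then have "(0::complex)\<^sup>2 + c = 1\<^sup>2 + c" unfolding constant_on_def by (metis UNIV_I)
        then show False by simp
      qed
      ultimately have "open ((\<lambda>z. z\<^sup>2 + c) ` (?h ` U))"
        by (intro open_mapping_thm[of "\<lambda>z. z\<^sup>2 + c" UNIV]) (auto intro!: holomorphic_intros)
      then show ?thesis by (simp add: f_def image_comp)
    qed
    have "surj (\<lambda>z. z\<^sup>2 + c)"
      by (rule surjI[of _ "\<lambda>w. csqrt (w - c)"]) simp
    then show "surj f"
      unfolding f_def using surj comp_surj by blast
    show "f z = f w \<longleftrightarrow> z = w \<or> z = - w" for z w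
    proof -
      have "f z = f w \<longleftrightarrow> ?h z = ?h w \<or> ?h z = ?h (- w)"
        by (simp add: f_def power2_eq_iff linear_neg[OF lin])
      then show ?thesis using inj by (simp add: inj_eq)
    qed
    show "R > 0" unfolding R_def using m by (auto intro!: divide_pos_pos add_pos_nonneg)
    show "2 * cmod z \<le> cmod (f z)" if "R \<le> cmod z" for z
    proof -
      have sq: "0 < m\<^sup>2" "m\<^sup>2 \<le> 1" using m by (auto simp: power_le_one)
      have R: "2 + cmod c \<le> m\<^sup>2 * cmod z"
        using that sq by (simp add: R_def field_simps)
      also have "\<dots> \<le> 1 * cmod z"
        using sq by (intro mult_right_mono) auto
      finally have z1: "1 \<le> cmod z" using norm_ge_zero[of c] by linarith
      have "(2 + cmod c) * cmod z \<le> (m\<^sup>2 * cmod z) * cmod z"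
        using R by (intro mult_right_mono) auto
      also have "\<dots> = (m * cmod z)\<^sup>2" by (simp add: power2_eq_square)
      also have "\<dots> \<le> (cmod (?h z))\<^sup>2"
        using h_ge m by (intro power_mono) auto
      also have "\<dots> = cmod ((?h z)\<^sup>2)" by (simp add: norm_power)
      also have "\<dots> - cmod c \<le> cmod (f z)"
        unfolding f_def o_def by (rule norm_diff_ineq)
      finally have "(2 + cmod c) * cmod z - cmod c \<le> cmod (f z)" by simp
      moreover have "cmod c * 1 \<le> cmod c * cmod z"
        using z1 by (intro mult_left_mono) auto
      ultimately show ?thesis by (simp add: algebra_simps)
    qed
  qed
  then show ?thesis ..
qed

theorem theorem5p3:
  fixes f :: "complex \<Rightarrow> complex"
  assumes "f \<in> QA"
  shows "connected (bounded_orbit_set f) \<longleftrightarrow> escaping_set f \<inter> branch_set f = {}"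
proof -
  obtain R where "even_expanding_map f R"
    using assms even_expanding_map_QA unfolding QA_def by blast
  then show ?thesis
    by (rule even_expanding_map.connected_iff)
qed

end
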